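(* Let $\mathbb{A}$ and $\mathbb{B}$ be two tensors of order $m\ge 3$ and dimension $n$, and for a tensor $\mathbb{T}$ let $N(\mathbb{T})$ denote the number of nonzero entries of $\mathbb{T}$. If $\mathbb{A}$ and $\mathbb{B}$ are similar, then $N(\mathbb{A})=N(\mathbb{B})$.
   Context: Write $[n]=\{1,\ldots,n\}$. An order $m$ dimension $n$ tensor $\mathbb{A}=(a_{i_1i_2\ldots i_m})$ is a multidimensional array of complex numbers $a_{i_1\ldots i_m}$ indexed by $i_1,\ldots,i_m\in[n]$. The unit tensor of order $m$ and dimension $n$ is $\mathbb{I}=(\delta_{i_1\ldots i_m})$ with $\delta_{i_1\ldots i_m}=1$ if $i_1=\cdots=i_m$ and $0$ otherwise. For complex matrices $P=(p_{ij}),Q=(q_{ij})$ of order $n$ and a tensor $\mathbb{A}$ of order $m$ and dimension $n$, the product $P\mathbb{A}Q$ is the order $m$ dimension $n$ tensor with entries $$(P\mathbb{A}Q)_{i_1\ldots i_m}=\sum_{j_1,\ldots,j_m=1}^n p_{i_1j_1}a_{j_1j_2\ldots j_m}q_{j_2i_2}\cdots q_{j_mi_m}.$$ Two order $m$ dimension $n$ tensors $\mathbb{A},\mathbb{B}$ are similar if there exist matrices $P,Q$ of order $n$ with $P\mathbb{I}Q=\mathbb{I}$ and $\mathbb{B}=P\mathbb{A}Q$. *)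

theory Defs
  imports "HOL-Analysis.Analysis"
begin

text \<open>The dimension n is the cardinality of the finite index type 'n, which plays the role of [n].
  A multi-index (i_1, ..., i_m) is a list of length m; the list position k (counted from 0)
  holds i_{k+1}.\<close>

definition multi_indices :: "nat \<Rightarrow> 'n list set" where
  "multi_indices m = {is. length is = m}"

lemma finite_multi_indices: "finite (multi_indices m :: 'n::finite list set)"
  using finite_lists_length_eq[of "UNIV :: 'n set" m] by (simp add: multi_indices_def)

text \<open>Tensors are extensional functions, so that equality of functions is entrywise equality of
  tensors.\<close>

definition tensors :: "nat \<Rightarrow> ('n::finite list \<Rightarrow> complex) set" where
  "tensors m = multi_indices m \<rightarrow>\<^sub>E UNIV"

definition unit_tensor :: "nat \<Rightarrow> 'n::finite list \<Rightarrow> complex" where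
  "unit_tensor m =
     (\<lambda>is\<in>multi_indices m. if \<forall>i\<in>set is. \<forall>j\<in>set is. i = j then 1 else 0)"

text \<open>The tensor P A Q of order m.  P acts on the first index from the left, and Q acts on each of
  the remaining m - 1 indices from the right.\<close>

definition tensor_prod ::
  "nat \<Rightarrow> complex^'n^'n \<Rightarrow> ('n::finite list \<Rightarrow> complex) \<Rightarrow> complex^'n^'n \<Rightarrow> 'n list \<Rightarrow> complex"
where
  "tensor_prod m P A Q =
     (\<lambda>is\<in>multi_indices m.
        \<Sum>js\<in>multi_indices m.
          P $ (is ! 0) $ (js ! 0) * A js * (\<Prod>k = 1..<m. Q $ (js ! k) $ (is ! k)))"

lemma unit_tensor_in_tensors: "unit_tensor m \<in> tensors m"
  by (simp add: unit_tensor_def tensors_def)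

lemma tensor_prod_in_tensors: "tensor_prod m P A Q \<in> tensors m"
  by (simp add: tensor_prod_def tensors_def)

definition similar_tensors ::
  "nat \<Rightarrow> ('n::finite list \<Rightarrow> complex) \<Rightarrow> ('n list \<Rightarrow> complex) \<Rightarrow> bool"
where
  "similar_tensors m A B \<longleftrightarrow>
     (\<exists>P Q :: complex^'n^'n.
        tensor_prod m P (unit_tensor m) Q = unit_tensor m \<and> B = tensor_prod m P A Q)"

definition num_nonzero :: "nat \<Rightarrow> ('n::finite list \<Rightarrow> complex) \<Rightarrow> nat" where
  "num_nonzero m T = card {is \<in> multi_indices m. T is \<noteq> 0}"

end

theory Submission imports Defs begin

text \<open>Write \<open>D\<close> for the unit tensor.  The point is that, for order at least 3, an equation
  \<open>P D Q = D\<close> forces \<open>P\<close> and \<open>Q\<close> to be monomial matrices (a permutation matrix times an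
  invertible diagonal matrix) with mutually inverse permutations.  A similarity then merely permutes
  the entries of a tensor and rescales each of them by a nonzero factor, so it cannot change the
  number of nonzero entries.

  To see that \<open>P\<close> and \<open>Q\<close> are monomial, let \<open>R\<close> arise from \<open>Q\<close> by raising every entry to the power
  \<open>m - 1\<close>.  The entries of \<open>P D Q = D\<close> at \<open>(a, i, \<dots>, i)\<close> say that \<open>P R\<close> is the identity matrix, so
  \<open>R P\<close> is the identity as well.  The entries at \<open>(a, i, i', \<dots>, i')\<close> with \<open>i \<noteq> i'\<close> say that \<open>P\<close> kills
  the vector with components \<open>Q $ j $ i * Q $ j $ i' ^ (m - 2)\<close>; since \<open>P\<close> is
  invertible the vector is zero.  As \<open>m - 2 > 0\<close>, no row of \<open>Q\<close>, and hence none of \<open>R\<close>, has two nonzero entries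
  (\<open>unit_stabilizer_row\<close>), and \<open>R P = 1\<close> then determines where \<open>P\<close> and \<open>Q\<close> vanish
  (\<open>unit_stabilizer_monomial\<close>).\<close>

lemma tensor_prod_unit:
  fixes P Q :: "complex^'n::finite^'n"
  assumes m: "m \<ge> 1" and len: "length is = m"
  shows "tensor_prod m P (unit_tensor m) Q is
    = (\<Sum>j\<in>UNIV. P $ (is ! 0) $ j * (\<Prod>k = 1..<m. Q $ j $ (is ! k)))"
proof -
  let ?f = "\<lambda>js. P $ (is ! 0) $ (js ! 0) * unit_tensor m js * (\<Prod>k = 1..<m. Q $ (js ! k) $ (is ! k))"
  let ?D = "replicate m ` (UNIV :: 'n set)"
  have inj: "inj (replicate m :: 'n \<Rightarrow> 'n list)"
    using m by (auto simp: inj_on_def)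
  have "?f js = 0" if js: "js \<in> multi_indices m - ?D" for js
  proof -
    have "\<not> (\<forall>i\<in>set js. \<forall>j\<in>set js. i = j)"
    proof
      assume "\<forall>i\<in>set js. \<forall>j\<in>set js. i = j"
      then have "js = replicate m (js ! 0)"
        using js m by (intro nth_equalityI) (auto simp: multi_indices_def)
      then show False using js by blast
    qed
    then show ?thesis using js by (auto simp: unit_tensor_def)
  qed
  then have "sum ?f (multi_indices m) = sum ?f ?D"
    by (intro sum.mono_neutral_right finite_multi_indices) (auto simp: multi_indices_def)
  also have "\<dots> = (\<Sum>j\<in>UNIV. ?f (replicate m j))"
    using inj by (subst sum.reindex) auto
  also have "\<dots> = (\<Sum>j\<in>UNIV. P $ (is ! 0) $ j * (\<Prod>k = 1..<m. Q $ j $ (is ! k)))"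
    using m by (intro sum.cong refl) (auto simp: unit_tensor_def multi_indices_def)
  finally show ?thesis
    using len by (simp add: tensor_prod_def multi_indices_def)
qed

text \<open>Multi-indices that are constant behind the first position give the opposite product,
  \<open>P R = 1\<close> for \<open>R\<close> the entrywise power of \<open>Q\<close>; a right inverse of a square matrix is also a left
  inverse.\<close>

lemma unit_stabilizer_left_inverse:
  fixes P Q :: "complex^'n::finite^'n"
  assumes m: "m \<ge> 2" and stab: "tensor_prod m P (unit_tensor m) Q = unit_tensor m"
  shows "(\<chi> j i. Q $ j $ i ^ (m - 1)) ** P = mat 1"
proof -
  have "(P ** (\<chi> j i. Q $ j $ i ^ (m - 1))) $ a $ i = mat 1 $ a $ i" for a i
  proof -
    let ?is = "a # replicate (m - 1) i"
    have len: "length ?is = m" using m by simp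
    have prod: "(\<Prod>k = 1..<m. Q $ j $ (?is ! k)) = Q $ j $ i ^ (m - 1)" for j
    proof -
      have "(\<Prod>k = 1..<m. Q $ j $ (?is ! k)) = (\<Prod>k = 1..<m. Q $ j $ i)"
        by (intro prod.cong refl) auto
      then show ?thesis by simp
    qed
    have "(P ** (\<chi> j i. Q $ j $ i ^ (m - 1))) $ a $ i
      = (\<Sum>j\<in>UNIV. P $ (?is ! 0) $ j * (\<Prod>k = 1..<m. Q $ j $ (?is ! k)))"
      unfolding matrix_matrix_mult_def prod by simp
    also have "\<dots> = unit_tensor m ?is"
      using tensor_prod_unit[OF _ len, of P Q] stab m by simp
    also have "\<dots> = mat 1 $ a $ i"
      using m len by (auto simp: unit_tensor_def multi_indices_def mat_def)
    finally show ?thesis .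
  qed
  then have "P ** (\<chi> j i. Q $ j $ i ^ (m - 1)) = mat 1"
    by (simp add: vec_eq_iff)
  then show ?thesis
    by (simp add: matrix_left_right_inverse)
qed

text \<open>This is where order at least 3 enters: only then does a multi-index have room for two distinct
  values behind its first position.\<close>

lemma unit_stabilizer_row:
  fixes P Q :: "complex^'n::finite^'n"
  assumes m: "m \<ge> 3" and stab: "tensor_prod m P (unit_tensor m) Q = unit_tensor m"
    and "i \<noteq> i'"
  shows "Q $ j $ i = 0 \<or> Q $ j $ i' = 0"
proof -
  define v where "v = (\<chi> j. Q $ j $ i * Q $ j $ i' ^ (m - 2))"
  have "(P *v v) $ a = 0" for a
  proof -
    let ?is = "a # i # replicate (m - 2) i'"
    have len: "length ?is = m" using m by simp
    have "(\<Prod>k = 1..<m. Q $ j $ (?is ! k)) = v $ j" for j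
    proof -
      have "(\<Prod>k = 1..<m. Q $ j $ (?is ! k)) = Q $ j $ i * (\<Prod>k = 2..<m. Q $ j $ (?is ! k))"
        using m by (subst prod.atLeast_Suc_lessThan) (auto simp: numeral_2_eq_2)
      also have "(\<Prod>k = 2..<m. Q $ j $ (?is ! k)) = (\<Prod>k = 2..<m. Q $ j $ i')"
        by (intro prod.cong refl) (auto simp: nth_Cons split: nat.split)
      finally show ?thesis by (simp add: v_def)
    qed
    then have "(P *v v) $ a
      = (\<Sum>j\<in>UNIV. P $ (?is ! 0) $ j * (\<Prod>k = 1..<m. Q $ j $ (?is ! k)))"
      by (simp add: matrix_vector_mult_def)
    also have "\<dots> = unit_tensor m ?is"
      using tensor_prod_unit[OF _ len, of P Q] stab m by simp
    also have "\<dots> = 0"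
      using m len \<open>i \<noteq> i'\<close> by (auto simp: unit_tensor_def multi_indices_def)
    finally show ?thesis .
  qed
  then have "P *v v = 0" by (simp add: vec_eq_iff)
  then have "(\<chi> j i. Q $ j $ i ^ (m - 1)) *v (P *v v) = 0" by simp
  then have "v = 0"
    using m unit_stabilizer_left_inverse[OF _ stab] by (simp add: matrix_vector_mul_assoc)
  then have "v $ j = 0" by simp
  then show ?thesis using m by (auto simp: v_def)
qed

text \<open>Let \<open>R\<close> be the entrywise power \<open>m - 1\<close> of \<open>Q\<close>, and let \<open>\<sigma> j\<close> be the column of the only
  nonzero entry in row \<open>j\<close> of \<open>Q\<close>.  Row \<open>j\<close> of \<open>R P = 1\<close> then collapses to
  \<open>R $ j $ \<sigma> j * P $ \<sigma> j $ l = mat 1 $ j $ l\<close>: row \<open>\<sigma> j\<close> of \<open>P\<close> is nonzero exactly in column \<open>j\<close>, so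
  \<open>j\<close> can be recovered from \<open>\<sigma> j\<close> and \<open>\<sigma>\<close> is a permutation.\<close>

lemma unit_stabilizer_monomial:
  fixes P Q :: "complex^'n::finite^'n"
  assumes m: "m \<ge> 3" and stab: "tensor_prod m P (unit_tensor m) Q = unit_tensor m"
  obtains \<sigma> :: "'n \<Rightarrow> 'n" where "bij \<sigma>"
    and "\<And>i j. P $ i $ j \<noteq> 0 \<longleftrightarrow> i = \<sigma> j"
    and "\<And>i j. Q $ j $ i \<noteq> 0 \<longleftrightarrow> i = \<sigma> j"
proof -
  have RP: "(\<Sum>i\<in>UNIV. Q $ j $ i ^ (m - 1) * P $ i $ l) = (if j = l then 1 else 0)" for j l
  proof -
    have "((\<chi> j i. Q $ j $ i ^ (m - 1)) ** P) $ j $ l = mat 1 $ j $ l"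
      using unit_stabilizer_left_inverse[OF _ stab] m by simp
    then show ?thesis by (simp add: matrix_matrix_mult_def mat_def)
  qed
  have "\<exists>i. Q $ j $ i \<noteq> 0" for j
  proof (rule ccontr)
    assume "\<nexists>i. Q $ j $ i \<noteq> 0"
    then show False using RP[of j j] m by (simp add: power_0_left)
  qed
  then obtain \<sigma> where \<sigma>: "\<And>j. Q $ j $ \<sigma> j \<noteq> 0" by metis
  have Q: "Q $ j $ i \<noteq> 0 \<longleftrightarrow> i = \<sigma> j" for i j
    using unit_stabilizer_row[OF m stab, of i "\<sigma> j" j] \<sigma>[of j] by auto
  have P\<sigma>: "P $ \<sigma> j $ l \<noteq> 0 \<longleftrightarrow> j = l" for j l
  proof -
    have "(\<Sum>i\<in>UNIV. Q $ j $ i ^ (m - 1) * P $ i $ l)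
      = (\<Sum>i\<in>{\<sigma> j}. Q $ j $ i ^ (m - 1) * P $ i $ l)"
      using m Q by (intro sum.mono_neutral_right) auto
    then have "Q $ j $ \<sigma> j ^ (m - 1) * P $ \<sigma> j $ l = (if j = l then 1 else 0)"
      using RP[of j l] by simp
    then show ?thesis using \<sigma>[of j] by (auto split: if_splits)
  qed
  have "inj \<sigma>"
  proof (rule injI)
    fix j l assume "\<sigma> j = \<sigma> l"
    then show "j = l" using P\<sigma>[of j l] P\<sigma>[of l l] by simp
  qed
  then have "bij \<sigma>" by (simp add: bij_def finite_UNIV_inj_surj)
  moreover have "P $ i $ j \<noteq> 0 \<longleftrightarrow> i = \<sigma> j" for i j
    using P\<sigma> \<open>bij \<sigma>\<close> by (metis bij_pointE)
  ultimately show ?thesis using Q that by blast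
qed

text \<open>In the sum defining the entry of \<open>P A Q\<close> at \<open>map \<sigma> js\<close>, an entry of \<open>A\<close> has a nonzero
  coefficient only if it stands at \<open>js\<close>, so the sum collapses to a nonzero multiple of \<open>A js\<close>.\<close>

lemma tensor_prod_monomial_nonzero_iff:
  fixes P Q :: "complex^'n::finite^'n"
  assumes m: "m \<ge> 1" and len: "length js = m" and "inj \<sigma>"
    and P: "\<And>i j. P $ i $ j \<noteq> 0 \<longleftrightarrow> i = \<sigma> j"
    and Q: "\<And>i j. Q $ j $ i \<noteq> 0 \<longleftrightarrow> i = \<sigma> j"
  shows "tensor_prod m P A Q (map \<sigma> js) \<noteq> 0 \<longleftrightarrow> A js \<noteq> 0"
proof -
  define c where "c ks = P $ (map \<sigma> js ! 0) $ (ks ! 0)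
    * (\<Prod>k = 1..<m. Q $ (ks ! k) $ (map \<sigma> js ! k))" for ks
  have c: "c ks \<noteq> 0 \<longleftrightarrow> ks = js" if ks: "length ks = m" for ks
  proof -
    have "c ks \<noteq> 0 \<longleftrightarrow> \<sigma> (js ! 0) = \<sigma> (ks ! 0) \<and> (\<forall>k\<in>{1..<m}. \<sigma> (js ! k) = \<sigma> (ks ! k))"
      using m len P Q by (simp add: c_def)
    also have "\<dots> \<longleftrightarrow> (\<forall>k<m. js ! k = ks ! k)"
    proof -
      have "{..<m} = insert 0 {1..<m}" using m by auto
      then have "(\<forall>k<m. js ! k = ks ! k) \<longleftrightarrow> (\<forall>k\<in>insert 0 {1..<m}. js ! k = ks ! k)"
        by (metis lessThan_iff)
      then show ?thesis using \<open>inj \<sigma>\<close> by (simp add: inj_eq)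
    qed
    also have "\<dots> \<longleftrightarrow> ks = js"
      using len ks by (auto simp: list_eq_iff_nth_eq)
    finally show ?thesis .
  qed
  have "tensor_prod m P A Q (map \<sigma> js) = (\<Sum>ks\<in>multi_indices m. c ks * A ks)"
    using len by (simp add: tensor_prod_def multi_indices_def c_def mult_ac)
  also have "\<dots> = (\<Sum>ks\<in>{js}. c ks * A ks)"
    using len c
    by (intro sum.mono_neutral_right finite_multi_indices) (auto simp: multi_indices_def)
  finally show ?thesis using c[OF len] by simp
qed

theorem corollary3p3:
  fixes A B :: "'n::finite list \<Rightarrow> complex" and m :: nat
  assumes "m \<ge> 3"
    and "A \<in> tensors m" and "B \<in> tensors m"
    and "similar_tensors m A B"
  shows "num_nonzero m A = num_nonzero m B"
proof -
  obtain P Q :: "complex^'n^'n" where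
    stab: "tensor_prod m P (unit_tensor m) Q = unit_tensor m" and B: "B = tensor_prod m P A Q"
    using \<open>similar_tensors m A B\<close> by (auto simp: similar_tensors_def)
  obtain \<sigma> where \<sigma>: "bij \<sigma>"
    and P: "\<And>i j. P $ i $ j \<noteq> 0 \<longleftrightarrow> i = \<sigma> j" and Q: "\<And>i j. Q $ j $ i \<noteq> 0 \<longleftrightarrow> i = \<sigma> j"
    using unit_stabilizer_monomial[OF \<open>m \<ge> 3\<close> stab] by blast
  have inj: "inj \<sigma>" and surj: "surj \<sigma>" using \<sigma> by (auto simp: bij_def)
  have nonzero: "B (map \<sigma> js) \<noteq> 0 \<longleftrightarrow> A js \<noteq> 0" if "js \<in> multi_indices m" for js
    using tensor_prod_monomial_nonzero_iff[OF _ _ inj P Q] that \<open>m \<ge> 3\<close>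
    by (simp add: B multi_indices_def)
  have "map \<sigma> ` {js \<in> multi_indices m. A js \<noteq> 0} = {is \<in> multi_indices m. B is \<noteq> 0}"
  proof (intro equalityI subsetI)
    fix xs assume "xs \<in> map \<sigma> ` {js \<in> multi_indices m. A js \<noteq> 0}"
    then show "xs \<in> {is \<in> multi_indices m. B is \<noteq> 0}"
      using nonzero by (auto simp: multi_indices_def)
  next
    fix xs assume xs: "xs \<in> {is \<in> multi_indices m. B is \<noteq> 0}"
    have "xs = map \<sigma> (map (inv \<sigma>) xs)"
      using surj by (simp add: surj_f_inv_f map_idI)
    then obtain js where "xs = map \<sigma> js" ..
    then show "xs \<in> map \<sigma> ` {js \<in> multi_indices m. A js \<noteq> 0}"
      using xs nonzero[of js] by (auto simp: multi_indices_def)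
  qed
  moreover have "inj_on (map \<sigma>) {js \<in> multi_indices m. A js \<noteq> 0}"
    by (rule inj_on_subset[OF inj_mapI[OF inj] subset_UNIV])
  ultimately show ?thesis
    unfolding num_nonzero_def using card_image by fastforce
qed

end
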